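(* Let $T$ be a pruned tree having a ray $R$ with uncountably many tops (i.e. $\mathrm{top}(R)$ is uncountable). Then the following are equivalent for a tree $T'$: (a) $\mathcal R(T')$ is discrete. (b) $\mathcal R(T)\times\mathcal R(T')$ is a ray space.
   Context: A tree is a partially ordered set $(T,\le)$ with a minimum (its root) such that $\lceil t\rceil=\{s\in T:s\le t\}$ is well-ordered for every $t\in T$. It is pruned if it has no maximal elements. A ray of $T$ is a non-empty downward closed chain of $T$ with no maximal element; $\mathcal R(T)$ is the set of all rays with the subspace topology inherited from the power set $\mathcal P(T)\simeq2^T$ (product topology). For a ray $R$, $\mathrm{top}(R)=\{s\in T\setminus R:\lceil s\rceil=R\cup\{s\}\}$ is its set of tops. A space is a ray space if it is homeomorphic to $\mathcal R(S)$ for some tree $S$. *)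

theory Defs
  imports "HOL-Analysis.Analysis"
begin

text \<open>A partially ordered set is a carrier \<open>T\<close> together with a relation \<open>r\<close> with
  \<open>partial_order_on T r\<close>, where \<open>(s, t) \<in> r\<close> means \<open>s \<le> t\<close>; the down-set of \<open>t\<close>
  is then the library's \<open>under r t\<close>.\<close>

definition order_tree :: "'a set \<Rightarrow> 'a rel \<Rightarrow> bool" where
  "order_tree T r \<longleftrightarrow>
     partial_order_on T r \<and>
     (\<exists>x\<in>T. \<forall>t\<in>T. (x, t) \<in> r) \<and>
     (\<forall>t\<in>T. well_order_on (under r t) (Restr r (under r t)))"

definition pruned :: "'a set \<Rightarrow> 'a rel \<Rightarrow> bool" where
  "pruned T r \<longleftrightarrow> \<not> (\<exists>t\<in>T. \<forall>s\<in>T. (t, s) \<in> r \<longrightarrow> s = t)"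

definition rays :: "'a set \<Rightarrow> 'a rel \<Rightarrow> 'a set set" where
  "rays T r = {R. R \<subseteq> T \<and> R \<noteq> {} \<and> (\<forall>t\<in>R. under r t \<subseteq> R) \<and> R \<in> Chains r \<and>
                  \<not> (\<exists>t\<in>R. \<forall>s\<in>R. (t, s) \<in> r \<longrightarrow> s = t)}"

definition tops :: "'a set \<Rightarrow> 'a rel \<Rightarrow> 'a set \<Rightarrow> 'a set" where
  "tops T r R = {s \<in> T - R. under r s = R \<union> {s}}"

text \<open>The topology on \<open>Pow T\<close> obtained by identifying a subset of \<open>T\<close> with its characteristic
  function in the product of \<open>T\<close>-many copies of the two-point discrete space.\<close>

definition powerset_topology :: "'a set \<Rightarrow> 'a set topology" where
  "powerset_topology T =
     pullback_topology (Pow T) (\<lambda>A. \<lambda>t\<in>T. t \<in> A)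
       (product_topology (\<lambda>_. discrete_topology (UNIV :: bool set)) T)"

definition ray_topology :: "'a set \<Rightarrow> 'a rel \<Rightarrow> 'a set topology" where
  "ray_topology T r = subtopology (powerset_topology T) (rays T r)"

text \<open>A ray space is a space homeomorphic to the space of rays of some tree. A definition in HOL
  cannot quantify over the type of the nodes of that tree, so it is fixed to be \<open>'x \<times> nat\<close>, for
  \<open>'x\<close> the type of the points. This is no restriction: the lemma \<open>ray_spaceI\<close> below shows that
  a tree with nodes of any type whatsoever will do.\<close>

definition ray_space :: "'x topology \<Rightarrow> bool" where
  "ray_space X \<longleftrightarrow>
     (\<exists>(S :: ('x \<times> nat) set) s. order_tree S s \<and> X homeomorphic_space ray_topology S s)"

lemma topspace_powerset_topology: "topspace (powerset_topology T) = Pow T"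
  by (auto simp: powerset_topology_def topspace_pullback_topology)

lemma topspace_ray_topology [simp]: "topspace (ray_topology T r) = rays T r"
  by (auto simp: ray_topology_def topspace_powerset_topology rays_def)

lemma continuous_map_into_ray_topology:
  assumes "g \<in> topspace X \<rightarrow> rays T r"
    and "\<And>t. t \<in> T \<Longrightarrow> continuous_map X (discrete_topology UNIV) (\<lambda>x. t \<in> g x)"
  shows "continuous_map X (ray_topology T r) g"
proof -
  have "continuous_map X (powerset_topology T) g"
    unfolding powerset_topology_def
  proof (rule continuous_map_pullback')
    show "continuous_map X (product_topology (\<lambda>_. discrete_topology (UNIV :: bool set)) T)
            ((\<lambda>A. \<lambda>t\<in>T. t \<in> A) \<circ> g)"
      unfolding continuous_map_componentwise
      using assms(2) by (auto simp: extensional_def)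
    show "topspace X \<subseteq> g -` Pow T"
      using assms(1) by (fastforce simp: rays_def Pi_iff)
  qed
  then show ?thesis
    unfolding ray_topology_def using assms(1) by (simp add: continuous_map_in_subtopology)
qed

lemma continuous_map_ray_topology_mem:
  assumes "t \<in> T"
  shows "continuous_map (ray_topology T r) (discrete_topology UNIV) (\<lambda>R. t \<in> R)"
proof -
  have "continuous_map (powerset_topology T) (discrete_topology UNIV)
          ((\<lambda>f. f t) \<circ> (\<lambda>A. \<lambda>t\<in>T. t \<in> A))"
    unfolding powerset_topology_def
    by (rule continuous_map_pullback)
      (rule continuous_map_product_projection[OF assms])
  moreover have "((\<lambda>f. f t) \<circ> (\<lambda>A. \<lambda>t\<in>T. t \<in> A)) = (\<lambda>R. t \<in> R)"
    using assms by auto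
  ultimately show ?thesis
    unfolding ray_topology_def by (auto intro: continuous_map_from_subtopology)
qed

text \<open>A tree may be replaced, up to homeomorphism of the space of rays, by a copy of any
  down-closed part that contains the root and all rays.\<close>

lemma order_tree_transport:
  fixes S :: "'c set" and g :: "'d \<Rightarrow> 'c"
  assumes tree: "order_tree S s"
    and C: "C \<subseteq> S" "\<And>t. t \<in> C \<Longrightarrow> under s t \<subseteq> C" "C \<noteq> {}" "\<Union>(rays S s) \<subseteq> C"
    and g: "bij_betw g D C"
  defines "r \<equiv> {(x, y). x \<in> D \<and> y \<in> D \<and> (g x, g y) \<in> s}"
  shows "order_tree D r" and "ray_topology S s homeomorphic_space ray_topology D r"
proof -
  have inj: "inj_on g D" and im: "g ` D = C"
    using g by (auto simp: bij_betw_def)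
  have po: "refl_on S s" "trans s" "antisym s" "s \<subseteq> S \<times> S"
    using tree unfolding order_tree_def by (auto dest: partial_order_onD)
  have po_r: "refl_on D r" "trans r" "antisym r" "r \<subseteq> D \<times> D"
  proof -
    show "refl_on D r"
      using po(1) im C(1) unfolding refl_on_def r_def by auto
    show "trans r"
      using po(2) unfolding trans_def r_def by blast
    show "antisym r"
      using po(3) inj unfolding antisym_def r_def inj_on_def by blast
  qed (auto simp: r_def)
  have under_r: "under r x = {y \<in> D. g y \<in> under s (g x)}" if "x \<in> D" for x
    using that by (auto simp: under_def r_def)
  have g_under: "g ` under r x = under s (g x)" if "x \<in> D" for x
    using C(2)[of "g x"] that im unfolding under_r[OF that] by auto
  show "order_tree D r"
    unfolding order_tree_def
  proof (intro conjI ballI)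
    show "partial_order_on D r"
      using po_r by (simp add: partial_order_on_def preorder_on_def)
    obtain c where c: "c \<in> S" "\<And>t. t \<in> S \<Longrightarrow> (c, t) \<in> s"
      using tree unfolding order_tree_def by blast
    from C(3) obtain t where "t \<in> C" by blast
    then have "c \<in> C"
      using c C(1) C(2)[of t] by (auto simp: under_def)
    then obtain x where "x \<in> D" "g x = c"
      using im by blast
    then show "\<exists>x\<in>D. \<forall>t\<in>D. (x, t) \<in> r"
      using c im C(1) by (auto simp: r_def intro!: bexI[of _ x])
  next
    fix x assume x: "x \<in> D"
    let ?U = "under r x" and ?V = "under s (g x)"
    have wo: "well_order_on ?V (Restr s ?V)"
      using tree x im C(1) unfolding order_tree_def by blast
    have U: "?U \<subseteq> D" "g ` ?U = ?V"
      using g_under[OF x] under_r[OF x] by auto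
    have "refl_on ?U (Restr r ?U)"
      using po_r(1) U(1) by (auto simp: refl_on_def)
    moreover have "trans (Restr r ?U)"
      using po_r(2) by (simp add: trans_Restr)
    moreover have "antisym (Restr r ?U)"
      using po_r(3) by (simp add: antisym_Restr)
    moreover have "total_on ?U (Restr r ?U)"
      unfolding total_on_def
    proof (intro ballI impI)
      fix a b assume ab: "a \<in> ?U" "b \<in> ?U" "a \<noteq> b"
      then have "g a \<noteq> g b"
        using U(1) inj by (auto simp: inj_on_def)
      moreover have "g a \<in> ?V" "g b \<in> ?V"
        using ab U(2) by auto
      ultimately have "(g a, g b) \<in> s \<or> (g b, g a) \<in> s"
        using wo unfolding well_order_on_def linear_order_on_def total_on_def by blast
      then show "(a, b) \<in> Restr r ?U \<or> (b, a) \<in> Restr r ?U"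
        using ab U(1) by (auto simp: r_def)
    qed
    moreover have "wf (Restr r ?U - Id)"
    proof (rule wf_subset)
      show "wf (inv_image (Restr s ?V - Id) g)"
        using wo by (simp add: well_order_on_def)
      show "Restr r ?U - Id \<subseteq> inv_image (Restr s ?V - Id) g"
      proof (clarsimp simp: inv_image_def)
        fix a b assume ab: "(a, b) \<in> r" "a \<in> ?U" "b \<in> ?U" "a \<noteq> b"
        then have "g a \<noteq> g b"
          using U(1) inj by (auto simp: inj_on_def)
        then show "(g a, g b) \<in> s \<and> g a \<in> ?V \<and> g b \<in> ?V \<and> g a \<noteq> g b"
          using ab U(2) by (auto simp: r_def)
      qed
    qed
    ultimately show "well_order_on ?U (Restr r ?U)"
      by (auto simp: well_order_on_def linear_order_on_def partial_order_on_def preorder_on_def)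
  qed
  have rays_iff: "R \<in> rays D r \<longleftrightarrow> g ` R \<in> rays S s" if R: "R \<subseteq> D" for R
  proof -
    have "(\<forall>t\<in>R. under r t \<subseteq> R) \<longleftrightarrow> (\<forall>t\<in>g ` R. under s t \<subseteq> g ` R)"
    proof -
      have "under r t \<subseteq> R \<longleftrightarrow> under s (g t) \<subseteq> g ` R" if "t \<in> R" for t
      proof -
        have t: "t \<in> D" using that R by blast
        have "under r t \<subseteq> D" using under_r[OF t] by blast
        then show ?thesis
          using inj_on_image_subset_iff[OF inj _ R] g_under[OF t] by metis
      qed
      then show ?thesis by simp
    qed
    moreover have "R \<in> Chains r \<longleftrightarrow> g ` R \<in> Chains s"
      using R unfolding Chains_def r_def by auto
    moreover have "(\<exists>t\<in>R. \<forall>u\<in>R. (t, u) \<in> r \<longrightarrow> u = t) \<longleftrightarrow>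
                   (\<exists>t\<in>g ` R. \<forall>u\<in>g ` R. (t, u) \<in> s \<longrightarrow> u = t)"
    proof -
      have "((t, u) \<in> r \<longrightarrow> u = t) \<longleftrightarrow> ((g t, g u) \<in> s \<longrightarrow> g u = g t)"
        if "t \<in> R" "u \<in> R" for t u
        using that R inj by (auto simp: r_def inj_on_def)
      then show ?thesis by simp
    qed
    moreover have "g ` R \<subseteq> S"
      using R im C(1) by blast
    ultimately show ?thesis
      using R unfolding rays_def by auto
  qed
  let ?F = "\<lambda>R. g ` R" and ?G = "\<lambda>R. g -` R \<inter> D"
  have GF: "?G (?F R) = R" if "R \<in> rays D r" for R
    using that inj by (auto simp: rays_def inj_on_def)
  have FG: "?F (?G R) = R" if "R \<in> rays S s" for R
    using that im C(4) by blast
  have F: "?F R \<in> rays S s" if "R \<in> rays D r" for R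
    using that rays_iff[of R] by (auto simp: rays_def)
  have G: "?G R \<in> rays D r" if "R \<in> rays S s" for R
    using that rays_iff[of "?G R"] FG[OF that] by auto
  have "continuous_map (ray_topology D r) (ray_topology S s) ?F"
  proof (rule continuous_map_into_ray_topology)
    fix t assume "t \<in> S"
    show "continuous_map (ray_topology D r) (discrete_topology UNIV) (\<lambda>x. t \<in> g ` x)"
    proof (cases "t \<in> C")
      case True
      then obtain x where x: "x \<in> D" "t = g x" using im by blast
      show ?thesis
      proof (rule continuous_map_eq[OF continuous_map_ray_topology_mem[OF x(1)]])
        fix R assume "R \<in> topspace (ray_topology D r)"
        then have "R \<subseteq> D" by (simp add: rays_def)
        then show "(x \<in> R) = (t \<in> g ` R)"
          using x inj by (auto simp: inj_on_def)
      qed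
    next
      case False
      show ?thesis
      proof (rule continuous_map_eq[of _ _ "\<lambda>_. False"])
        show "continuous_map (ray_topology D r) (discrete_topology UNIV) (\<lambda>_. False)"
          by simp
      qed (use False im in \<open>auto simp: rays_def\<close>)
    qed
  qed (use F in auto)
  moreover have "continuous_map (ray_topology S s) (ray_topology D r) ?G"
  proof (rule continuous_map_into_ray_topology)
    fix x assume x: "x \<in> D"
    then have "g x \<in> S" using im C(1) by blast
    from continuous_map_ray_topology_mem[OF this, of s] x
    show "continuous_map (ray_topology S s) (discrete_topology UNIV) (\<lambda>R. x \<in> g -` R \<inter> D)"
      by simp
  qed (use G in auto)
  ultimately show "ray_topology S s homeomorphic_space ray_topology D r"
    unfolding homeomorphic_space_def homeomorphic_maps_def
    using GF FG by (intro exI[of _ ?G] exI[of _ ?F]) auto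
qed

text \<open>The nodes lying on rays are coded by a ray and a natural number: send \<open>t\<close> to a
  ray \<open>P t\<close> that contains \<open>t\<close> and has only finitely many elements between \<open>t\<close> and any
  other of its elements; every fibre of \<open>P\<close> is then countable.\<close>

lemma ray_nodes_inj:
  fixes S :: "'c set"
  assumes tree: "order_tree S s"
  shows "\<exists>f :: 'c \<Rightarrow> 'c set \<times> nat. inj_on f (\<Union>(rays S s)) \<and>
           f ` (\<Union>(rays S s)) \<subseteq> rays S s \<times> UNIV"
proof -
  have po: "refl_on S s" "trans s" "antisym s" "s \<subseteq> S \<times> S"
    using tree unfolding order_tree_def by (auto dest: partial_order_onD)
  have rfl: "(t, t) \<in> s" if "t \<in> S" for t
    using po(1) that by (auto simp: refl_on_def)
  have tr: "(a, c) \<in> s" if "(a, b) \<in> s" "(b, c) \<in> s" for a b c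
    using po(2) that by (meson transD)
  have asym: "a = b" if "(a, b) \<in> s" "(b, a) \<in> s" for a b
    using po(3) that by (meson antisymD)
  define I where "I a b = {v. (a, v) \<in> s \<and> (v, b) \<in> s}" for a b
  have least: "\<exists>m\<in>A. \<forall>a\<in>A. (m, a) \<in> s" if Q: "Q \<in> rays S s" and A: "A \<subseteq> Q" "A \<noteq> {}" for Q A
  proof -
    obtain a where a: "a \<in> A" using A by blast
    have QS: "Q \<subseteq> S" using Q by (simp add: rays_def)
    have ch: "(x, y) \<in> s \<or> (y, x) \<in> s" if "x \<in> Q" "y \<in> Q" for x y
      using Q that by (auto simp: rays_def Chains_def)
    let ?V = "under s a"
    have aV: "a \<in> ?V" using a A QS rfl by (auto simp: under_def)
    have "a \<in> S" using a A QS by blast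
    then have "wf (Restr s ?V - Id)"
      using tree unfolding order_tree_def well_order_on_def by blast
    then obtain m where m: "m \<in> A \<inter> ?V" "\<And>y. (y, m) \<in> Restr s ?V - Id \<Longrightarrow> y \<notin> A \<inter> ?V"
      using a aV unfolding wf_eq_minimal by (metis IntI)
    have "(m, b) \<in> s" if b: "b \<in> A" for b
    proof (rule ccontr)
      assume n: "(m, b) \<notin> s"
      then have bm: "(b, m) \<in> s" "b \<noteq> m" using ch[of m b] rfl m(1) b A QS by blast+
      then have "b \<in> ?V" using m(1) tr by (auto simp: under_def)
      with bm m b show False by blast
    qed
    with m(1) show ?thesis by blast
  qed
  have "\<exists>P. P \<in> rays S s \<and> t \<in> P \<and> (\<forall>u\<in>P. finite (I t u))" if t: "t \<in> \<Union>(rays S s)" for t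
  proof -
    obtain Q where Q: "Q \<in> rays S s" "t \<in> Q" using t by blast
    have QS: "Q \<subseteq> S" and dc: "\<And>x y. x \<in> Q \<Longrightarrow> (y, x) \<in> s \<Longrightarrow> y \<in> Q"
      and ch: "\<And>x y. x \<in> Q \<Longrightarrow> y \<in> Q \<Longrightarrow> (x, y) \<in> s \<or> (y, x) \<in> s"
      and nomax: "\<And>x. x \<in> Q \<Longrightarrow> \<exists>y\<in>Q. (x, y) \<in> s \<and> y \<noteq> x"
      using Q(1) by (auto simp: rays_def Chains_def under_def)
    define P where "P = {u \<in> Q. finite (I t u)}"
    have "I t t \<subseteq> {t}" using asym by (auto simp: I_def)
    then have tP: "t \<in> P" using Q(2) by (auto simp: P_def intro: finite_subset)
    have "P \<in> rays S s"
    proof -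
      have "under s u \<subseteq> P" if "u \<in> P" for u
      proof
        fix w assume w: "w \<in> under s u"
        then have "I t w \<subseteq> I t u" using tr by (auto simp: I_def under_def)
        then show "w \<in> P"
          using that w dc[of u w] by (auto simp: P_def under_def intro: finite_subset)
      qed
      moreover have "\<exists>y\<in>P. (u, y) \<in> s \<and> y \<noteq> u" if u: "u \<in> P" for u
      proof -
        have uQ: "u \<in> Q" using u by (simp add: P_def)
        let ?A = "{y \<in> Q. (u, y) \<in> s \<and> y \<noteq> u}"
        have "?A \<noteq> {}" using nomax[OF uQ] by blast
        then obtain m where m: "m \<in> ?A" "\<And>a. a \<in> ?A \<Longrightarrow> (m, a) \<in> s"
          using least[OF Q(1), of ?A] by blast
        have "I t m \<subseteq> insert m (I t u)"
        proof
          fix v assume v: "v \<in> I t m"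
          then have vm: "(v, m) \<in> s" "(t, v) \<in> s" by (auto simp: I_def)
          then have vQ: "v \<in> Q" using dc m(1) by blast
          show "v \<in> insert m (I t u)"
          proof (cases "(v, u) \<in> s")
            case True
            then show ?thesis using vm by (simp add: I_def)
          next
            case False
            then have "v \<in> ?A" using ch[OF uQ vQ] rfl uQ vQ QS by auto
            then show ?thesis using m(2) vm asym by blast
          qed
        qed
        then have "m \<in> P" using m(1) u by (auto simp: P_def intro: finite_subset)
        then show ?thesis using m(1) by blast
      qed
      moreover have "P \<subseteq> S" "P \<in> Chains s"
        using QS ch by (auto simp: P_def Chains_def)
      ultimately show ?thesis
        using tP unfolding rays_def by blast
    qed
    with tP show ?thesis by (auto simp: P_def)
  qed
  then obtain P where P: "\<And>t. t \<in> \<Union>(rays S s) \<Longrightarrow> P t \<in> rays S s \<and> t \<in> P t \<and> (\<forall>u\<in>P t. finite (I t u))"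
    by metis
  define F where "F R = {t \<in> \<Union>(rays S s). P t = R}" for R
  have FR: "F R \<subseteq> R" for R using P by (auto simp: F_def)
  have "\<exists>m\<in>F R. \<forall>a\<in>F R. (m, a) \<in> s" if "F R \<noteq> {}" for R
  proof -
    have "R \<in> rays S s" using that P by (auto simp: F_def)
    then show ?thesis using least[OF _ FR that] by blast
  qed
  then obtain m where m: "\<And>R. F R \<noteq> {} \<Longrightarrow> m R \<in> F R \<and> (\<forall>a\<in>F R. (m R, a) \<in> s)"
    by metis
  define f where "f t = (P t, card (I (m (P t)) t))" for t
  have less: "card (I (m R) a) < card (I (m R) b)"
    if "a \<in> F R" "b \<in> F R" "(a, b) \<in> s" "a \<noteq> b" for R a b
  proof (rule psubset_card_mono)
    have mR: "m R \<in> F R" "(m R, b) \<in> s" using m[of R] that by auto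
    then have "m R \<in> \<Union>(rays S s)" "P (m R) = R" by (auto simp: F_def)
    then show "finite (I (m R) b)" using P[of "m R"] that FR by blast
    have "b \<in> S" using that(3) po(4) by blast
    then have "b \<in> I (m R) b" using mR rfl by (simp add: I_def)
    moreover have "b \<notin> I (m R) a" using that asym by (auto simp: I_def)
    moreover have "I (m R) a \<subseteq> I (m R) b" using that tr by (auto simp: I_def)
    ultimately show "I (m R) a \<subset> I (m R) b" by blast
  qed
  have "inj_on f (\<Union>(rays S s))"
  proof (rule inj_onI, rule ccontr)
    fix a b assume ab: "a \<in> \<Union>(rays S s)" "b \<in> \<Union>(rays S s)" "f a = f b" "a \<noteq> b"
    then have F: "a \<in> F (P a)" "b \<in> F (P a)" and R: "P a \<in> rays S s"
      and c: "card (I (m (P a)) a) = card (I (m (P a)) b)"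
      using P by (auto simp: F_def f_def)
    have "(a, b) \<in> s \<or> (b, a) \<in> s"
    proof -
      have "a \<in> P a" "b \<in> P a" using F FR by blast+
      moreover have "P a \<in> Chains s" using R by (simp add: rays_def)
      ultimately show ?thesis unfolding Chains_def by blast
    qed
    then show False
      using less[OF F] less[OF F(2,1)] ab(4) c by auto
  qed
  moreover have "f ` \<Union>(rays S s) \<subseteq> rays S s \<times> UNIV"
    using P by (auto simp: f_def)
  ultimately show ?thesis by blast
qed

lemma ray_spaceI:
  fixes S :: "'c set" and X :: "'x topology"
  assumes tree: "order_tree S s" and hom: "X homeomorphic_space ray_topology S s"
  shows "ray_space X"
proof -
  have po: "trans s" "antisym s" "s \<subseteq> S \<times> S"
    using tree unfolding order_tree_def by (auto dest: partial_order_onD)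
  obtain c where c: "c \<in> S" "\<And>t. t \<in> S \<Longrightarrow> (c, t) \<in> s"
    using tree unfolding order_tree_def by blast
  have uc: "under s c \<subseteq> {c}"
    using c po(2,3) by (auto simp: under_def dest: antisymD)
  define C where "C = (if rays S s = {} then {c} else \<Union>(rays S s))"
  have C: "C \<subseteq> S" "\<And>t. t \<in> C \<Longrightarrow> under s t \<subseteq> C" "C \<noteq> {}" "\<Union>(rays S s) \<subseteq> C"
  proof -
    show "C \<subseteq> S" using c by (auto simp: C_def rays_def)
    show "under s t \<subseteq> C" if "t \<in> C" for t
    proof (cases "rays S s = {}")
      case True
      then show ?thesis using \<open>t \<in> C\<close> uc by (simp add: C_def)
    next
      case False
      then obtain R where R: "R \<in> rays S s" "t \<in> R" using \<open>t \<in> C\<close> by (auto simp: C_def)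
      then have "under s t \<subseteq> R" by (simp add: rays_def)
      then show ?thesis using R False by (auto simp: C_def)
    qed
    show "C \<noteq> {}"
    proof (cases "rays S s = {}")
      case False
      then obtain R where "R \<in> rays S s" by blast
      moreover then have "R \<noteq> {}" by (simp add: rays_def)
      ultimately show ?thesis using False by (auto simp: C_def)
    qed (simp add: C_def)
    show "\<Union>(rays S s) \<subseteq> C" by (auto simp: C_def)
  qed
  obtain k where k: "inj_on k (rays S s)" "k ` rays S s \<subseteq> topspace X"
  proof -
    obtain f g where "homeomorphic_maps X (ray_topology S s) f g"
      using hom unfolding homeomorphic_space_def by blast
    then have "g \<in> rays S s \<rightarrow> topspace X" and fg: "\<And>R. R \<in> rays S s \<Longrightarrow> f (g R) = R"
      unfolding homeomorphic_maps_def continuous_map_def by simp_all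
    moreover have "inj_on g (rays S s)"
      by (rule inj_on_inverseI[where g = f]) (rule fg)
    ultimately have "inj_on g (rays S s)" "g ` rays S s \<subseteq> topspace X"
      by blast+
    then show thesis using that by blast
  qed
  obtain h :: "'c \<Rightarrow> 'x \<times> nat" where h: "inj_on h C"
  proof (cases "rays S s = {}")
    case True
    then have "inj_on (\<lambda>_. undefined :: 'x \<times> nat) C" by (simp add: C_def)
    then show ?thesis by (rule that)
  next
    case False
    obtain f :: "'c \<Rightarrow> 'c set \<times> nat" where f: "inj_on f (\<Union>(rays S s))"
      "f ` (\<Union>(rays S s)) \<subseteq> rays S s \<times> UNIV"
      using ray_nodes_inj[OF tree] by (elim exE conjE)
    have "inj_on (map_prod k id) (rays S s \<times> (UNIV :: nat set))"
      using k(1) by (simp add: map_prod_inj_on)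
    then have "inj_on (map_prod k id) (f ` \<Union>(rays S s))"
      using f(2) by (rule inj_on_subset)
    with f(1) have "inj_on (map_prod k id \<circ> f) (\<Union>(rays S s))"
      by (rule comp_inj_on)
    then have "inj_on (map_prod k id \<circ> f) C"
      using False by (simp add: C_def)
    then show ?thesis by (rule that)
  qed
  let ?D = "h ` C" and ?g = "inv_into C h"
  let ?r = "{(x, y). x \<in> ?D \<and> y \<in> ?D \<and> (?g x, ?g y) \<in> s}"
  have g: "bij_betw ?g ?D C"
    using h by (simp add: bij_betw_inv_into inj_on_imp_bij_betw)
  note tp = order_tree_transport[OF tree C g]
  have "X homeomorphic_space ray_topology ?D ?r"
    by (rule homeomorphic_space_trans[OF hom tp(2)])
  with tp(1) show ?thesis
    unfolding ray_space_def by (intro exI conjI)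
qed

end

theory Submission
  imports Defs
begin

text \<open>If the second factor is discrete, the product is a disjoint sum of copies of the first, and
  grafting the corresponding copies of \<open>T\<close> onto a new root gives a tree for it.

  Conversely, let \<open>f\<close> be a homeomorphism from the product onto the ray space of \<open>S\<close>, and suppose
  that \<open>y\<close> is a non-isolated ray of \<open>T'\<close>. Choose a ray \<open>W x\<close> through every top \<open>x\<close> of \<open>R\<close>; the
  family \<open>W\<close> converges to \<open>R\<close>, so \<open>f (W x, y)\<close> converges to \<open>Q = f (R, y)\<close>. An uncountable
  family of rays can converge to \<open>Q\<close> only if all but countably many of them extend \<open>Q\<close>, and so
  pass through tops \<open>u x\<close> of \<open>Q\<close>, each top being used finitely often. By continuity \<open>f (W x, z)\<close>
  still contains \<open>u x\<close> for \<open>z\<close> close to \<open>y\<close>, and some \<open>z \<noteq> y\<close> is close enough for infinitely many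
  \<open>x\<close> at once. Rays through infinitely many distinct tops of \<open>Q\<close> converge to \<open>Q\<close>, while
  \<open>f (W x, z)\<close> converges to \<open>f (R, z) \<noteq> Q\<close>.\<close>

section \<open>Order theory of trees\<close>

lemma order_tree_refl: "order_tree T r \<Longrightarrow> t \<in> T \<Longrightarrow> (t, t) \<in> r"
  unfolding order_tree_def partial_order_on_def preorder_on_def refl_on_def by blast

lemma order_tree_trans: "order_tree T r \<Longrightarrow> (a, b) \<in> r \<Longrightarrow> (b, c) \<in> r \<Longrightarrow> (a, c) \<in> r"
  unfolding order_tree_def partial_order_on_def preorder_on_def by (meson transD)

lemma order_tree_antisym: "order_tree T r \<Longrightarrow> (a, b) \<in> r \<Longrightarrow> (b, a) \<in> r \<Longrightarrow> a = b"
  unfolding order_tree_def partial_order_on_def by (meson antisymD)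

lemma order_tree_field: "order_tree T r \<Longrightarrow> (a, b) \<in> r \<Longrightarrow> a \<in> T \<and> b \<in> T"
  unfolding order_tree_def by (auto dest: partial_order_onD)

lemma order_tree_linear:
  assumes "order_tree T r" "(a, c) \<in> r" "(b, c) \<in> r"
  shows "(a, b) \<in> r \<or> (b, a) \<in> r"
proof -
  have "c \<in> T" using assms order_tree_field by metis
  then have "total_on (under r c) (Restr r (under r c))"
    using assms(1) unfolding order_tree_def well_order_on_def linear_order_on_def by blast
  moreover have "(a, a) \<in> r"
    using assms order_tree_field order_tree_refl by metis
  ultimately show ?thesis
    using assms(2,3) by (cases "a = b") (auto simp: total_on_def under_def)
qed

text \<open>Well-foundedness is given only inside down-sets. A minimal element of \<open>A\<close>
  within the down-set of \<open>a\<close> is minimal in all of \<open>A\<close>, because whatever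
  lies below it belongs to that down-set too.\<close>

lemma order_tree_minimal:
  assumes "order_tree T r" "a \<in> A" "A \<subseteq> T"
  obtains m where "m \<in> A" "\<And>y. (y, m) \<in> r \<Longrightarrow> y \<noteq> m \<Longrightarrow> y \<notin> A"
proof -
  let ?V = "under r a"
  have "a \<in> T" using assms by blast
  then have aV: "a \<in> ?V" and wf: "wf (Restr r ?V - Id)"
    using assms(1) order_tree_refl[OF assms(1)]
    unfolding order_tree_def well_order_on_def under_def by blast+
  then obtain m where m: "m \<in> A \<inter> ?V" "\<And>y. (y, m) \<in> Restr r ?V - Id \<Longrightarrow> y \<notin> A \<inter> ?V"
    using assms(2) unfolding wf_eq_minimal by (metis IntI)
  show thesis
  proof (rule that)
    fix y assume y: "(y, m) \<in> r" "y \<noteq> m"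
    then have "y \<in> ?V" using m(1) order_tree_trans[OF assms(1)] by (auto simp: under_def)
    then show "y \<notin> A" using m y by blast
  qed (use m in blast)
qed

text \<open>Linearity and well-foundedness are asked of the whole relation instead of each down-set,
  which suits the grafted tree constructed below.\<close>

lemma order_treeI:
  assumes po: "partial_order_on T r" and root: "x \<in> T" "\<And>t. t \<in> T \<Longrightarrow> (x, t) \<in> r"
    and lin: "\<And>a b c. (a, c) \<in> r \<Longrightarrow> (b, c) \<in> r \<Longrightarrow> (a, b) \<in> r \<or> (b, a) \<in> r"
    and wf: "wf (r - Id)"
  shows "order_tree T r"
  unfolding order_tree_def
proof (intro conjI ballI)
  fix t assume "t \<in> T"
  let ?U = "under r t"
  have "r \<subseteq> T \<times> T" "refl_on T r" "trans r" "antisym r"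
    using po by (auto dest: partial_order_onD)
  then have "refl_on ?U (Restr r ?U)" "trans (Restr r ?U)" "antisym (Restr r ?U)"
    by (auto simp: refl_on_def under_def trans_Restr antisym_Restr)
  moreover have "total_on ?U (Restr r ?U)"
    using lin by (auto simp: total_on_def under_def)
  moreover have "wf (Restr r ?U - Id)"
    by (rule wf_subset[OF wf]) blast
  ultimately show "well_order_on ?U (Restr r ?U)"
    by (auto simp: well_order_on_def linear_order_on_def partial_order_on_def preorder_on_def)
qed (use po root in auto)

section \<open>Rays and their tops\<close>

lemma rays_subset: "R \<in> rays T r \<Longrightarrow> R \<subseteq> T"
  by (simp add: rays_def)

lemma rays_down: "R \<in> rays T r \<Longrightarrow> t \<in> R \<Longrightarrow> (s, t) \<in> r \<Longrightarrow> s \<in> R"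
  by (auto simp: rays_def under_def)

lemma rays_comparable: "R \<in> rays T r \<Longrightarrow> s \<in> R \<Longrightarrow> t \<in> R \<Longrightarrow> (s, t) \<in> r \<or> (t, s) \<in> r"
  by (auto simp: rays_def Chains_def)

lemma rays_no_max: "R \<in> rays T r \<Longrightarrow> t \<in> R \<Longrightarrow> \<exists>s\<in>R. (t, s) \<in> r \<and> s \<noteq> t"
  unfolding rays_def by blast

lemma tops_strict_below: "s \<in> tops T r Q \<Longrightarrow> (t, s) \<in> r \<Longrightarrow> t \<noteq> s \<Longrightarrow> t \<in> Q"
  by (auto simp: tops_def under_def)

lemma rays_subset_if_top:
  assumes "s \<in> tops T r Q" "s \<in> W" "W \<in> rays T r"
  shows "Q \<subseteq> W"
proof -
  have "Q \<subseteq> under r s" using assms(1) by (auto simp: tops_def)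
  then show ?thesis using assms(2,3) rays_down by (fastforce simp: under_def)
qed

text \<open>A minimal element of \<open>W - Q\<close> is a top: it is comparable with every element
  of \<open>Q\<close> and, \<open>Q\<close> being downward closed, lies below none of them;
  minimality excludes any further predecessor.\<close>

lemma rays_psubset_top:
  assumes T: "order_tree T r" and Q: "Q \<in> rays T r" and W: "W \<in> rays T r" and sub: "Q \<subset> W"
  shows "\<exists>s\<in>W. s \<in> tops T r Q"
proof -
  obtain a where a: "a \<in> W - Q" using sub by blast
  have "W - Q \<subseteq> T" using W rays_subset by blast
  then obtain s where s: "s \<in> W - Q" and min: "\<And>y. (y, s) \<in> r \<Longrightarrow> y \<noteq> s \<Longrightarrow> y \<notin> W - Q"
    using order_tree_minimal[OF T a] by blast
  have "s \<in> T" using s W rays_subset by blast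
  moreover have "under r s = Q \<union> {s}"
  proof
    show "under r s \<subseteq> Q \<union> {s}"
      using min rays_down[OF W] s by (auto simp: under_def)
    show "Q \<union> {s} \<subseteq> under r s"
    proof
      fix q assume q: "q \<in> Q \<union> {s}"
      then have "(q, s) \<in> r \<or> (s, q) \<in> r" using rays_comparable[OF W] s sub by blast
      moreover have "q = s" if "(s, q) \<in> r" using that q s rays_down[OF Q] by blast
      ultimately show "q \<in> under r s" by (auto simp: under_def)
    qed
  qed
  ultimately show ?thesis using s by (auto simp: tops_def)
qed

section \<open>Neighbourhoods in the ray topology\<close>

lemma openin_rays_agree:
  assumes "finite F" "F \<subseteq> T"
  shows "openin (ray_topology T r) {Q \<in> rays T r. Q \<inter> F = R \<inter> F}"
  using assms
proof induction
  case empty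
  show ?case using openin_topspace[of "ray_topology T r"] by simp
next
  case (insert t F)
  have "openin (ray_topology T r) {Q \<in> rays T r. (t \<in> Q) \<in> {t \<in> R}}"
    using openin_continuous_map_preimage[OF continuous_map_ray_topology_mem, of t T "{t \<in> R}" r]
      insert.prems by simp
  moreover have "openin (ray_topology T r) {Q \<in> rays T r. Q \<inter> F = R \<inter> F}"
    using insert by blast
  ultimately have "openin (ray_topology T r)
      ({Q \<in> rays T r. (t \<in> Q) \<in> {t \<in> R}} \<inter> {Q \<in> rays T r. Q \<inter> F = R \<inter> F})"
    by (rule openin_Int)
  also have "\<dots> = {Q \<in> rays T r. Q \<inter> insert t F = R \<inter> insert t F}"
    by blast
  finally show ?case .
qed

text \<open>A basic box of the product restricts only finitely many coordinates, so finitely many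
  nodes decide a neighbourhood of a ray. This is the form in which neighbourhoods are used
  later.\<close>

lemma openin_ray_topology_iff:
  "openin (ray_topology T r) U \<longleftrightarrow> U \<subseteq> rays T r \<and>
     (\<forall>R\<in>U. \<exists>F. finite F \<and> F \<subseteq> T \<and> (\<forall>Q\<in>rays T r. Q \<inter> F = R \<inter> F \<longrightarrow> Q \<in> U))"
  (is "?L \<longleftrightarrow> ?R")
proof
  assume L: ?L
  then have sub: "U \<subseteq> rays T r" using openin_subset by fastforce
  let ?f = "\<lambda>A. \<lambda>t\<in>T. t \<in> A"
  obtain V where V: "openin (product_topology (\<lambda>_. discrete_topology (UNIV :: bool set)) T) V"
    and U: "U = (?f -` V \<inter> Pow T) \<inter> rays T r"
    using L unfolding ray_topology_def powerset_topology_def openin_subtopology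
      openin_pullback_topology by blast
  have "\<exists>F. finite F \<and> F \<subseteq> T \<and> (\<forall>Q\<in>rays T r. Q \<inter> F = R \<inter> F \<longrightarrow> Q \<in> U)" if R: "R \<in> U" for R
  proof -
    have "?f R \<in> V" using R U by blast
    then obtain W where W: "finite {i \<in> T. W i \<noteq> UNIV}" "?f R \<in> Pi\<^sub>E T W" "Pi\<^sub>E T W \<subseteq> V"
      using V unfolding openin_product_topology_alt by fastforce
    let ?F = "{i \<in> T. W i \<noteq> UNIV}"
    have "Q \<in> U" if Q: "Q \<in> rays T r" "Q \<inter> ?F = R \<inter> ?F" for Q
    proof -
      have "(t \<in> Q) \<in> W t" if t: "t \<in> T" for t
      proof (cases "t \<in> ?F")
        case True
        then have "(t \<in> Q) = (t \<in> R)" using Q(2) by blast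
        moreover have "(t \<in> R) \<in> W t" using W(2) t by (auto simp: PiE_def Pi_def)
        ultimately show ?thesis by simp
      qed (use t in auto)
      then have "?f Q \<in> V" using W(3) by (auto simp: PiE_def Pi_def)
      then show ?thesis using Q U rays_subset[OF Q(1)] by blast
    qed
    then show ?thesis using W(1) by (intro exI[of _ ?F]) blast
  qed
  with sub show ?R by blast
next
  assume R: ?R
  show ?L
  proof (subst openin_subopen, intro ballI)
    fix R assume RU: "R \<in> U"
    then obtain F where F: "finite F" "F \<subseteq> T" "\<And>Q. Q \<in> rays T r \<Longrightarrow> Q \<inter> F = R \<inter> F \<Longrightarrow> Q \<in> U"
      using R by metis
    show "\<exists>V. openin (ray_topology T r) V \<and> R \<in> V \<and> V \<subseteq> U"
      using openin_rays_agree[OF F(1,2), of r R] F(3) RU R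
      by (intro exI[of _ "{Q \<in> rays T r. Q \<inter> F = R \<inter> F}"]) auto
  qed
qed

lemma openin_ray_topologyE:
  assumes "openin (ray_topology T r) U" "R \<in> U"
  obtains F where "finite F" "F \<subseteq> T" "\<And>Q. Q \<in> rays T r \<Longrightarrow> Q \<inter> F = R \<inter> F \<Longrightarrow> Q \<in> U"
  using assms unfolding openin_ray_topology_iff by metis

section \<open>Convergence to a ray and non-isolated rays\<close>

text \<open>The convergence holds because a node outside \<open>Q\<close> lies above at most one top of \<open>Q\<close>.\<close>

lemma tops_converge:
  assumes T: "order_tree T r"
    and W: "\<And>x. x \<in> X \<Longrightarrow> W x \<in> rays T r" and s: "\<And>x. x \<in> X \<Longrightarrow> s x \<in> tops T r Q \<inter> W x"
    and fin: "\<And>u. finite {x \<in> X. s x = u}" and F: "finite F"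
  shows "finite {x \<in> X. W x \<inter> F \<noteq> Q \<inter> F}"
proof -
  have above: "(s x, t) \<in> r" if "x \<in> X" "t \<in> W x" "t \<notin> Q" for x t
    using rays_comparable[OF W, of x "s x" t] s[of x] tops_strict_below[of "s x" T r Q t] that by blast
  \<comment> \<open>Two tops below a common node are comparable, and the strictly smaller of two
    comparable tops would lie in \<open>Q\<close>.\<close>
  have "s x = s y" if "x \<in> X" "y \<in> X" "t \<in> W x" "t \<in> W y" "t \<notin> Q" for x y t
  proof -
    have "(s x, s y) \<in> r \<or> (s y, s x) \<in> r"
      using order_tree_linear[OF T] above that by blast
    then show ?thesis
      using tops_strict_below[of "s x" T r Q "s y"] tops_strict_below[of "s y" T r Q "s x"]
        s[of x] s[of y] that(1,2) by (auto simp: tops_def)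
  qed
  note same_top = this
  have "finite {x \<in> X. t \<in> W x}" if "t \<notin> Q" for t
  proof (cases "\<exists>y\<in>X. t \<in> W y")
    case True
    then obtain y where y: "y \<in> X" "t \<in> W y" by blast
    show ?thesis
      by (rule finite_subset[OF _ fin[of "s y"]]) (use y same_top that in blast)
  qed (auto intro: finite_subset[of _ "{}"])
  then have "finite (\<Union>t\<in>F - Q. {x \<in> X. t \<in> W x})" using F by blast
  \<comment> \<open>Each \<open>W x\<close> passes through a top of \<open>Q\<close> and so contains
    \<open>Q\<close>; it can differ from \<open>Q\<close> only at nodes outside
    \<open>Q\<close>.\<close>
  moreover have "{x \<in> X. W x \<inter> F \<noteq> Q \<inter> F} \<subseteq> (\<Union>t\<in>F - Q. {x \<in> X. t \<in> W x})"
    using rays_subset_if_top[OF _ _ W] s by blast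
  ultimately show ?thesis by (rule finite_subset[rotated])
qed

text \<open>If \<open>R\<close> has countable cofinality this is the pigeonhole principle; otherwise every countable
  subset of \<open>R\<close> is bounded in \<open>R\<close>.\<close>

lemma ray_infinitely_often_bounded:
  assumes R: "R \<in> rays T r" and X: "uncountable X" and b: "\<And>x. x \<in> X \<Longrightarrow> b x \<in> R"
  shows "\<exists>t\<in>R. infinite {x \<in> X. (b x, t) \<in> r}"
proof (rule ccontr)
  assume "\<not> ?thesis"
  then have fin: "\<And>t. t \<in> R \<Longrightarrow> finite {x \<in> X. (b x, t) \<in> r}" by blast
  have "infinite X" using X uncountable_infinite by blast
  then obtain Y where Y: "Y \<subseteq> X" "infinite Y" "countable Y"
    using infinite_countable_subset' by blast
  \<comment> \<open>If no \<open>b y\<close> lay above \<open>b x\<close>, comparability would put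
    all of the infinitely many \<open>b y\<close> below \<open>b x\<close>, against
    \<open>fin\<close>. Hence \<open>X\<close> is covered by countably many finite sets.\<close>
  have "\<exists>y\<in>Y. (b x, b y) \<in> r" if x: "x \<in> X" for x
  proof (rule ccontr)
    assume "\<not> ?thesis"
    then have "Y \<subseteq> {y \<in> X. (b y, b x) \<in> r}"
      using rays_comparable[OF R b b] Y(1) x by blast
    then show False using fin[OF b[OF x]] Y(2) finite_subset by blast
  qed
  then have "X \<subseteq> (\<Union>y\<in>Y. {x \<in> X. (b x, b y) \<in> r})" by blast
  moreover have "countable (\<Union>y\<in>Y. {x \<in> X. (b x, b y) \<in> r})"
    using Y fin b by (intro countable_UN) (auto intro: countable_finite)
  ultimately show False using X countable_subset by blast
qed

text \<open>A ray that leaves \<open>R\<close> late enough looks like \<open>R\<close> on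
  \<open>F\<close>. For a node \<open>t\<close> of \<open>F\<close> in \<open>R\<close>, take
  \<open>t\<close> itself as the bound. For \<open>t\<close> outside \<open>R\<close>, either some
  \<open>e\<close> in \<open>R\<close> is not below \<open>t\<close>, and then \<open>e\<close> and
  \<open>t\<close> are incomparable and share no ray, or \<open>t\<close> lies above all of
  \<open>R\<close>, and then a ray through \<open>t\<close> contains \<open>R\<close>. Finitely many
  bounds in \<open>R\<close> have a common upper bound in \<open>R\<close>.\<close>

lemma ray_agree_bound:
  assumes T: "order_tree T r" and R: "R \<in> rays T r" and F: "finite F" "F \<subseteq> T"
  shows "\<exists>b\<in>R. \<forall>z\<in>rays T r. b \<in> z \<longrightarrow> \<not> R \<subseteq> z \<longrightarrow> z \<inter> F = R \<inter> F"
  using F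
proof induction
  case empty
  show ?case using R by (auto simp: rays_def)
next
  case (insert t F)
  then obtain b where b: "b \<in> R" "\<And>z. z \<in> rays T r \<Longrightarrow> b \<in> z \<Longrightarrow> \<not> R \<subseteq> z \<Longrightarrow> z \<inter> F = R \<inter> F"
    by blast
  obtain c where c: "c \<in> R" "\<And>z. z \<in> rays T r \<Longrightarrow> c \<in> z \<Longrightarrow> \<not> R \<subseteq> z \<Longrightarrow> t \<in> z \<longleftrightarrow> t \<in> R"
  proof (cases "t \<in> R")
    case True
    then show ?thesis using that[of t] by blast
  next
    case tR: False
    show ?thesis
    proof (cases "\<exists>e\<in>R. (e, t) \<notin> r")
      case True
      then obtain e where e: "e \<in> R" "(e, t) \<notin> r" by blast
      show ?thesis
      proof (rule that[OF e(1)])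
        fix z assume z: "z \<in> rays T r" "e \<in> z"
        then show "t \<in> z \<longleftrightarrow> t \<in> R"
          using rays_comparable[OF z(1), of e t] e rays_down[OF R e(1)] tR by blast
      qed
    next
      case False
      show ?thesis
      \<comment> \<open>Any element of \<open>R\<close> would do here; \<open>b\<close> is merely at
        hand.\<close>
      proof (rule that[OF b(1)])
        fix z assume z: "z \<in> rays T r" "\<not> R \<subseteq> z"
        then show "t \<in> z \<longleftrightarrow> t \<in> R"
          using False rays_down[OF z(1)] tR by blast
      qed
    qed
  qed
  obtain d where d: "d \<in> R" "(b, d) \<in> r" "(c, d) \<in> r"
    using rays_comparable[OF R b(1) c(1)] b(1) c(1) order_tree_refl[OF T] rays_subset[OF R] by blast
  have "z \<inter> insert t F = R \<inter> insert t F" if z: "z \<in> rays T r" "d \<in> z" "\<not> R \<subseteq> z" for z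
  proof -
    have "b \<in> z" "c \<in> z" using rays_down[OF z(1,2)] d by blast+
    then show ?thesis using b(2)[of z] c(2)[of z] z by blast
  qed
  then show ?case using d(1) by blast
qed

text \<open>If infinitely many tops of \<open>R\<close> lie on rays, then rays through them converge to \<open>R\<close> and one of
  them serves as \<open>z\<close> by the pigeonhole principle. Otherwise every node \<open>t\<close> of \<open>R\<close> lies on a ray
  \<open>z t\<close> that leaves \<open>R\<close> above \<open>t\<close>.\<close>

lemma nonisolated_ray_common_point:
  assumes T: "order_tree T r" and R: "R \<in> rays T r" and niso: "\<not> openin (ray_topology T r) {R}"
    and X: "uncountable X"
    and U: "\<And>x. x \<in> X \<Longrightarrow> openin (ray_topology T r) (U x)" "\<And>x. x \<in> X \<Longrightarrow> R \<in> U x"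
  shows "\<exists>z\<in>rays T r. z \<noteq> R \<and> infinite {x \<in> X. z \<in> U x}"
proof -
  have "\<exists>F. finite F \<and> F \<subseteq> T \<and> (\<forall>Q\<in>rays T r. Q \<inter> F = R \<inter> F \<longrightarrow> Q \<in> U x)" if "x \<in> X" for x
    using U[OF that] unfolding openin_ray_topology_iff by blast
  then obtain F where F: "\<And>x. x \<in> X \<Longrightarrow> finite (F x) \<and> F x \<subseteq> T"
    "\<And>x Q. x \<in> X \<Longrightarrow> Q \<in> rays T r \<Longrightarrow> Q \<inter> F x = R \<inter> F x \<Longrightarrow> Q \<in> U x"
    by metis
  \<comment> \<open>The tree is not assumed pruned, so a top of \<open>R\<close> may lie on no ray
    at all; only those that do can be approached by rays.\<close>
  define K where "K = {s \<in> tops T r R. \<exists>z\<in>rays T r. s \<in> z}"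
  show ?thesis
  proof (cases "finite K")
    case False
    then obtain e :: "nat \<Rightarrow> 'a" where e: "inj e" "range e \<subseteq> K"
      using infinite_countable_subset by blast
    then have "\<forall>n. \<exists>z. z \<in> rays T r \<and> e n \<in> z" by (auto simp: K_def)
    then obtain z where z: "\<And>n. z n \<in> rays T r" "\<And>n. e n \<in> z n" by metis
    have top: "e n \<in> tops T r R" for n using e(2) by (auto simp: K_def)
    have "\<exists>n. z n \<in> U x" if x: "x \<in> X" for x
    proof -
      have "finite {n \<in> UNIV. z n \<inter> F x \<noteq> R \<inter> F x}"
      proof (rule tops_converge[OF T])
        show "finite {n \<in> UNIV. e n = u}" for u
          using finite_vimageI[OF _ e(1), of "{u}"] by (simp add: vimage_def)
      qed (use z top F x in auto)
      then obtain n where "n \<notin> {n \<in> UNIV. z n \<inter> F x \<noteq> R \<inter> F x}"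
        using ex_new_if_finite infinite_UNIV_nat by blast
      then show ?thesis using F(2)[OF x z(1)] by blast
    qed
    then have "X = (\<Union>n. {x \<in> X. z n \<in> U x})" by blast
    then obtain n where "uncountable {x \<in> X. z n \<in> U x}"
      using X by (metis (lifting) countable_UN countableI_type)
    moreover have "z n \<noteq> R" using z(2)[of n] top[of n] by (auto simp: tops_def)
    ultimately show ?thesis
      using z(1) uncountable_infinite by (intro bexI[of _ "z n"] conjI)
  next
    case True
    have KT: "K \<subseteq> T" by (auto simp: K_def tops_def)
    have RK: "R \<inter> K = {}" by (auto simp: K_def tops_def)
    have "\<exists>z\<in>rays T r. t \<in> z \<and> \<not> R \<subseteq> z" if t: "t \<in> R" for t
    proof -
      have "insert t K \<subseteq> T" using t KT rays_subset[OF R] by blast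
      \<comment> \<open>As \<open>K\<close> is finite, agreement with \<open>R\<close> on
        \<open>insert t K\<close> is an open condition, so the non-isolated \<open>R\<close> shares
        it with another ray. That ray avoids \<open>K\<close>, whereas a ray properly containing
        \<open>R\<close> would meet \<open>K\<close>.\<close>
      then have "{z \<in> rays T r. z \<inter> insert t K = R \<inter> insert t K} \<noteq> {R}"
        using openin_rays_agree[of "insert t K" T r R] True niso by auto
      then obtain z where z: "z \<in> rays T r" "z \<inter> insert t K = R \<inter> insert t K" "z \<noteq> R"
        using R by auto
      have "\<not> R \<subseteq> z"
      proof
        assume "R \<subseteq> z"
        then obtain s where "s \<in> z" "s \<in> tops T r R"
          using rays_psubset_top[OF T R z(1)] z(3) by blast
        then show False using z RK by (auto simp: K_def)
      qed
      then show ?thesis using z t by blast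
    qed
    then obtain z where z: "\<And>t. t \<in> R \<Longrightarrow> z t \<in> rays T r \<and> t \<in> z t \<and> \<not> R \<subseteq> z t"
      by metis
    have "\<forall>x\<in>X. \<exists>b\<in>R. \<forall>z\<in>rays T r. b \<in> z \<longrightarrow> \<not> R \<subseteq> z \<longrightarrow> z \<inter> F x = R \<inter> F x"
      using ray_agree_bound[OF T R] F(1) by simp
    then obtain b where "\<forall>x\<in>X. b x \<in> R \<and>
        (\<forall>z\<in>rays T r. b x \<in> z \<longrightarrow> \<not> R \<subseteq> z \<longrightarrow> z \<inter> F x = R \<inter> F x)"
      unfolding Bex_def by (drule_tac bchoice) (elim exE)
    then have b: "\<And>x. x \<in> X \<Longrightarrow> b x \<in> R"
      "\<And>x z. x \<in> X \<Longrightarrow> z \<in> rays T r \<Longrightarrow> b x \<in> z \<Longrightarrow> \<not> R \<subseteq> z \<Longrightarrow> z \<in> U x"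
      using F(2) by simp_all
    \<comment> \<open>A ray that contains \<open>b x\<close> but not all of \<open>R\<close> lies in
      \<open>U x\<close>. Once \<open>t\<close> is above infinitely many \<open>b x\<close>, the
      single ray \<open>z t\<close> serves all these \<open>x\<close>.\<close>
    have "\<exists>t\<in>R. infinite {x \<in> X. (b x, t) \<in> r}"
      by (rule ray_infinitely_often_bounded[OF R X b(1)])
    then obtain t where t: "t \<in> R" "infinite {x \<in> X. (b x, t) \<in> r}"
      by (elim bexE)
    have zt: "z t \<in> rays T r" "t \<in> z t" "\<not> R \<subseteq> z t" using z[OF t(1)] by simp_all
    have "{x \<in> X. (b x, t) \<in> r} \<subseteq> {x \<in> X. z t \<in> U x}"
      using b(2)[OF _ zt(1) _ zt(3)] rays_down[OF zt(1,2)] by blast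
    then have "infinite {x \<in> X. z t \<in> U x}" using t(2) finite_subset by blast
    moreover have "z t \<noteq> R" using zt(3) by blast
    ultimately show ?thesis using zt(1) by (intro bexI[of _ "z t"] conjI)
  qed
qed

section \<open>A ray-space product forces a discrete second factor\<close>

text \<open>By Zorn, \<open>t\<close> lies in a maximal chain \<open>M\<close>. Maximality makes
  \<open>M\<close> downward closed, and a greatest element of \<open>M\<close> could be exceeded
  because the tree is pruned, so \<open>M\<close> is a ray.\<close>

lemma pruned_node_in_ray:
  assumes T: "order_tree T r" and pr: "pruned T r" and t: "t \<in> T"
  shows "\<exists>R\<in>rays T r. t \<in> R"
proof -
  let ?A = "{C. C \<subseteq> T \<and> t \<in> C \<and> C \<in> Chains r}"
  have "{t} \<in> ?A" using t order_tree_refl[OF T] by (auto simp: Chains_def)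
  then have ne: "?A \<noteq> {}" by blast
  have "\<exists>M\<in>?A. \<forall>X\<in>?A. M \<subseteq> X \<longrightarrow> X = M"
  proof (rule subset_Zorn_nonempty[OF ne])
    fix \<C> assume C: "\<C> \<noteq> {}" "subset.chain ?A \<C>"
    have sub: "\<C> \<subseteq> ?A" and ch: "\<And>X Y. X \<in> \<C> \<Longrightarrow> Y \<in> \<C> \<Longrightarrow> X \<subseteq> Y \<or> Y \<subseteq> X"
      using C(2) by (auto simp: subset_chain_def)
    have "(x, y) \<in> r \<or> (y, x) \<in> r" if "x \<in> \<Union>\<C>" "y \<in> \<Union>\<C>" for x y
    proof -
      obtain X where "X \<in> \<C>" "x \<in> X" "y \<in> X" using \<open>x \<in> \<Union>\<C>\<close> \<open>y \<in> \<Union>\<C>\<close> ch by blast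
      then have "X \<in> Chains r" using sub by blast
      then show ?thesis using \<open>x \<in> X\<close> \<open>y \<in> X\<close> by (auto simp: Chains_def)
    qed
    then show "\<Union>\<C> \<in> ?A" using sub C(1) by (auto simp: Chains_def)
  qed
  then obtain M where MA: "M \<in> ?A" and maxA: "\<forall>X\<in>?A. M \<subseteq> X \<longrightarrow> X = M"
    by (elim bexE)
  then have M: "M \<subseteq> T" "t \<in> M" "M \<in> Chains r" by simp_all
  have max: "X = M" if "X \<subseteq> T" "t \<in> X" "X \<in> Chains r" "M \<subseteq> X" for X
    using maxA that by simp
  have ch: "(x, y) \<in> r \<or> (y, x) \<in> r" if "x \<in> M" "y \<in> M" for x y
    using M(3) that by (auto simp: Chains_def)
  \<comment> \<open>Adding \<open>u\<close> to \<open>M\<close> gives a chain through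
    \<open>t\<close>, so maximality puts \<open>u\<close> in \<open>M\<close>. Both remaining ray
    properties are derived from this.\<close>
  have ins: "u \<in> M" if u: "u \<in> T" and cmp: "\<And>v. v \<in> M \<Longrightarrow> (u, v) \<in> r \<or> (v, u) \<in> r" for u
  proof -
    have "insert u M \<in> Chains r"
      using cmp ch order_tree_refl[OF T u] by (auto simp: Chains_def)
    then show ?thesis using max[of "insert u M"] u M by blast
  qed
  have "u \<in> M" if "c \<in> M" "(u, c) \<in> r" for u c
  proof (rule ins)
    show "u \<in> T" using order_tree_field[OF T] that by blast
    show "(u, v) \<in> r \<or> (v, u) \<in> r" if "v \<in> M" for v
      using ch[OF that \<open>c \<in> M\<close>] \<open>(u, c) \<in> r\<close> order_tree_linear[OF T] order_tree_trans[OF T] by blast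
  qed
  moreover have "\<not> (\<forall>s\<in>M. (m, s) \<in> r \<longrightarrow> s = m)" if m: "m \<in> M" for m
  proof
    assume top: "\<forall>s\<in>M. (m, s) \<in> r \<longrightarrow> s = m"
    obtain s where s: "s \<in> T" "(m, s) \<in> r" "s \<noteq> m"
      using pr m M(1) unfolding pruned_def by blast
    have "s \<in> M"
    proof (rule ins[OF s(1)])
      fix v assume "v \<in> M"
      then have "(v, m) \<in> r" using ch[OF m, of v] top order_tree_refl[OF T] m M(1) by blast
      then show "(s, v) \<in> r \<or> (v, s) \<in> r" using s order_tree_trans[OF T] by blast
    qed
    then show False using top s by blast
  qed
  ultimately have "M \<in> rays T r" using M unfolding rays_def by (auto simp: under_def)
  then show ?thesis using M by blast
qed

lemma discrete_if_prod_ray_space: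
  fixes T :: "'a set" and r :: "'a rel" and T' :: "'b set" and r' :: "'b rel"
  assumes T: "order_tree T r" and pr: "pruned T r"
    and R: "R \<in> rays T r" and unc: "uncountable (tops T r R)"
    and T': "order_tree T' r'"
    and rs: "ray_space (prod_topology (ray_topology T r) (ray_topology T' r'))"
  shows "ray_topology T' r' = discrete_topology (rays T' r')"
proof (rule ccontr)
  assume "\<not> ?thesis"
  then obtain y where y: "y \<in> rays T' r'" "\<not> openin (ray_topology T' r') {y}"
    by (metis discrete_topology_unique topspace_ray_topology)
  let ?P = "prod_topology (ray_topology T r) (ray_topology T' r')"
  obtain S :: "(('a set \<times> 'b set) \<times> nat) set" and s f g where S: "order_tree S s"
    and hm: "homeomorphic_maps ?P (ray_topology S s) f g"
    using rs unfolding ray_space_def homeomorphic_space_def by blast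
  have f: "continuous_map ?P (ray_topology S s) f"
    using hm by (simp add: homeomorphic_maps_def)
  have f_in: "f (w, z) \<in> rays S s" if "w \<in> rays T r" "z \<in> rays T' r'" for w z
    using continuous_map_funspace[OF f] that by auto
  have f_inj: "(w, z) = (w', z')" if "w \<in> rays T r" "z \<in> rays T' r'" "w' \<in> rays T r" "z' \<in> rays T' r'"
      "f (w, z) = f (w', z')" for w z w' z'
  proof -
    have "g (f p) = p" if "p \<in> rays T r \<times> rays T' r'" for p
      using hm that by (auto simp: homeomorphic_maps_def)
    then show ?thesis using that by (metis mem_Sigma_iff)
  qed
  let ?X = "tops T r R"
  have "\<exists>W. W \<in> rays T r \<and> x \<in> W" if "x \<in> ?X" for x
    using pruned_node_in_ray[OF T pr, of x] that by (auto simp: tops_def)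
  then obtain W where W: "\<And>x. x \<in> ?X \<Longrightarrow> W x \<in> rays T r" "\<And>x. x \<in> ?X \<Longrightarrow> x \<in> W x"
    by metis
  \<comment> \<open>As \<open>x\<close> runs through the tops, \<open>W x\<close> converges to
    \<open>R\<close>, each \<open>x\<close> being its own top (hence \<open>s = id\<close>). For
    fixed \<open>z\<close>, continuity carries this over to \<open>f (W x, z)\<close> and
    \<open>f (R, z)\<close>, one node \<open>t\<close> at a time.\<close>
  have conv: "finite {x \<in> ?X. t \<in> f (W x, z) \<longleftrightarrow> t \<notin> f (R, z)}"
    if z: "z \<in> rays T' r'" and t: "t \<in> S" for z t
  proof -
    define V where "V = {w \<in> rays T r. (t \<in> f (w, z)) \<in> {t \<in> f (R, z)}}"
    have "continuous_map (ray_topology T r) ?P (\<lambda>w. (w, z))"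
      using z by (simp add: continuous_map_pairedI)
    then have "continuous_map (ray_topology T r) (ray_topology S s) (f \<circ> (\<lambda>w. (w, z)))"
      using f by (rule continuous_map_compose)
    from continuous_map_compose[OF this continuous_map_ray_topology_mem[OF t]]
    have "continuous_map (ray_topology T r) (discrete_topology UNIV) (\<lambda>w. t \<in> f (w, z))"
      by (simp add: comp_def)
    from openin_continuous_map_preimage[OF this, of "{t \<in> f (R, z)}"]
    have "openin (ray_topology T r) V" by (simp add: V_def)
    moreover have "R \<in> V" using R by (simp add: V_def)
    ultimately obtain G where G: "finite G" "\<And>w. w \<in> rays T r \<Longrightarrow> w \<inter> G = R \<inter> G \<Longrightarrow> w \<in> V"
      by (metis openin_ray_topologyE)
    have "finite {x \<in> ?X. W x \<inter> G \<noteq> R \<inter> G}"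
    proof (rule tops_converge[OF T, where s = id])
      show "finite {x \<in> ?X. id x = u}" for u
        by (rule finite_subset[of _ "{u}"]) auto
    qed (use W G in auto)
    then show ?thesis
      by (rule finite_subset[rotated]) (use G(2) W(1) in \<open>auto simp: V_def\<close>)
  qed
  define Q where "Q = f (R, y)"
  define q where "q x = f (W x, y)" for x
  have Q: "Q \<in> rays S s" using f_in R y by (simp add: Q_def)
  have q: "q x \<in> rays S s" if "x \<in> ?X" for x using f_in W(1)[OF that] y by (simp add: q_def)
  have q_conv: "finite {x \<in> ?X. t \<in> q x \<longleftrightarrow> t \<notin> Q}" if "t \<in> S" for t
    using conv[OF y(1) that] by (simp add: q_def Q_def)
  have qQ: "q x \<noteq> Q" if "x \<in> ?X" for x
    using f_inj[OF W(1)[OF that] y(1) R y(1)] W(2)[OF that] that by (auto simp: q_def Q_def tops_def)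
  define B where "B = {x \<in> ?X. \<not> Q \<subseteq> q x}"
  \<comment> \<open>For \<open>x\<close> in \<open>B\<close> the ray \<open>q x\<close> omits some
    node \<open>b x\<close> of \<open>Q\<close>. Were \<open>B\<close> uncountable, one
    \<open>t\<close> in \<open>Q\<close> would lie above infinitely many \<open>b x\<close>; those
    \<open>q x\<close> omit \<open>t\<close> as well, contradicting convergence to
    \<open>Q\<close>.\<close>
  have "countable B"
  proof (rule ccontr)
    assume uncB: "uncountable B"
    define b where "b x = (SOME b. b \<in> Q - q x)" for x
    have b: "b x \<in> Q - q x" if "x \<in> B" for x
    proof -
      have "\<exists>b. b \<in> Q - q x" using that by (auto simp: B_def)
      then show ?thesis unfolding b_def by (rule someI_ex)
    qed
    have "\<exists>t\<in>Q. infinite {x \<in> B. (b x, t) \<in> s}"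
      by (rule ray_infinitely_often_bounded[OF Q uncB]) (use b in blast)
    then obtain t where t: "t \<in> Q" "infinite {x \<in> B. (b x, t) \<in> s}"
      by (elim bexE)
    have "t \<in> S" using t(1) rays_subset[OF Q] by blast
    then have "finite {x \<in> ?X. t \<in> q x \<longleftrightarrow> t \<notin> Q}" by (rule q_conv)
    moreover have "{x \<in> B. (b x, t) \<in> s} \<subseteq> {x \<in> ?X. t \<in> q x \<longleftrightarrow> t \<notin> Q}"
    proof
      fix x assume x: "x \<in> {x \<in> B. (b x, t) \<in> s}"
      then have "x \<in> ?X" "b x \<notin> q x" using b by (auto simp: B_def)
      then show "x \<in> {x \<in> ?X. t \<in> q x \<longleftrightarrow> t \<notin> Q}"
        using rays_down[OF q, of x t "b x"] x t(1) by blast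
    qed
    ultimately have "finite {x \<in> B. (b x, t) \<in> s}" by (rule finite_subset[rotated])
    with t(2) show False ..
  qed
  define A where "A = ?X - B"
  have uncA: "uncountable A"
    unfolding A_def using unc \<open>countable B\<close> by (simp add: uncountable_minus_countable)
  have AX: "x \<in> ?X" and AQ: "Q \<subset> q x" if "x \<in> A" for x
    using that qQ by (auto simp: A_def B_def)
  define u where "u x = (SOME u. u \<in> tops S s Q \<inter> q x)" for x
  have u: "u x \<in> tops S s Q \<inter> q x" if x: "x \<in> A" for x
  proof -
    have "\<exists>u. u \<in> tops S s Q \<inter> q x"
      using rays_psubset_top[OF S Q q[OF AX[OF x]] AQ[OF x]] by blast
    then show ?thesis unfolding u_def by (rule someI_ex)
  qed
  \<comment> \<open>A top \<open>v\<close> is outside \<open>Q\<close>, so by convergence to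
    \<open>Q\<close> only finitely many \<open>q x\<close> contain it.\<close>
  have ufin: "finite {x \<in> A. u x = v}" for v
  proof (cases "v \<in> tops S s Q")
    case True
    then have v: "v \<in> S" "v \<notin> Q" by (auto simp: tops_def)
    have "{x \<in> A. u x = v} \<subseteq> {x \<in> ?X. v \<in> q x \<longleftrightarrow> v \<notin> Q}"
      using v u AX by auto
    then show ?thesis using q_conv[OF v(1)] by (rule finite_subset)
  next
    case False
    then have "{x \<in> A. u x = v} = {}" using u by auto
    then show ?thesis by (simp only: finite.emptyI)
  qed
  \<comment> \<open>Each \<open>U x\<close> is an open neighbourhood of \<open>y\<close>, but an
    infinite intersection of them need not be one; the uncountability of \<open>A\<close> still
    yields a second ray common to infinitely many.\<close>
  define U where "U x = {z \<in> rays T' r'. u x \<in> f (W x, z)}" for x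
  have "\<exists>z\<in>rays T' r'. z \<noteq> y \<and> infinite {x \<in> A. z \<in> U x}"
  proof (rule nonisolated_ray_common_point[OF T' y uncA])
    fix x assume x: "x \<in> A"
    have "u x \<in> S" using u[OF x] by (auto simp: tops_def)
    note c = continuous_map_ray_topology_mem[OF this, of s]
    have "continuous_map (ray_topology T' r') ?P (\<lambda>z. (W x, z))"
      using W(1)[OF AX[OF x]] by (simp add: continuous_map_pairedI)
    from continuous_map_compose[OF continuous_map_compose[OF this f] c]
    have "continuous_map (ray_topology T' r') (discrete_topology UNIV) (\<lambda>z. u x \<in> f (W x, z))"
      by (simp add: comp_def)
    from openin_continuous_map_preimage[OF this, of "{True}"]
    show "openin (ray_topology T' r') (U x)" by (simp add: U_def)
    show "y \<in> U x" using u[OF x] y(1) by (simp add: U_def q_def)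
  qed
  then obtain z where z: "z \<in> rays T' r'" "z \<noteq> y" and inf: "infinite {x \<in> A. z \<in> U x}"
    by (elim bexE conjE)
  define C where "C = {x \<in> A. z \<in> U x}"
  have "f (R, z) \<noteq> Q" using f_inj[OF R z(1) R y(1)] z(2) by (auto simp: Q_def)
  then obtain t where t: "t \<in> f (R, z) \<longleftrightarrow> t \<notin> Q" by blast
  then have "t \<in> S" using rays_subset[OF Q] rays_subset[OF f_in[OF R z(1)]] by blast
  have "finite {x \<in> C. f (W x, z) \<inter> {t} \<noteq> Q \<inter> {t}}"
  proof (rule tops_converge[OF S])
    show "finite {x \<in> C. u x = v}" for v
      by (rule finite_subset[OF _ ufin[of v]]) (auto simp: C_def)
    fix x assume x: "x \<in> C"
    then show "f (W x, z) \<in> rays S s" using f_in W(1) AX z(1) by (auto simp: C_def)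
    show "u x \<in> tops S s Q \<inter> f (W x, z)" using u x by (auto simp: C_def U_def)
  qed simp
  moreover note conv[OF z(1) \<open>t \<in> S\<close>]
  \<comment> \<open>\<open>Q\<close> and \<open>f (R, z)\<close> differ at \<open>t\<close>, so
    every \<open>f (W x, z)\<close> disagrees there with one of the two limits. The two finite
    exceptional sets therefore cover \<open>C\<close>.\<close>
  ultimately have "finite ({x \<in> C. f (W x, z) \<inter> {t} \<noteq> Q \<inter> {t}} \<union>
      {x \<in> ?X. t \<in> f (W x, z) \<longleftrightarrow> t \<notin> f (R, z)})" by (rule finite_UnI)
  then have "finite C"
    by (rule finite_subset[rotated]) (use t AX in \<open>auto simp: C_def\<close>)
  with inf show False by (simp add: C_def)
qed

section \<open>Products with a discrete space\<close>

lemma ray_space_prod_discrete: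
  fixes T :: "'a set" and r :: "'a rel" and I :: "'i set"
  assumes T: "order_tree T r"
  shows "ray_space (prod_topology (ray_topology T r) (discrete_topology I))"
proof -
  \<comment> \<open>\<open>None\<close> is the new root and \<open>Some (i, a)\<close> the node
    \<open>a\<close> of copy \<open>i\<close>. If \<open>I\<close> is empty, only the root remains
    and there are no rays.\<close>
  define S :: "('i \<times> 'a) option set" where "S = insert None (Some ` (I \<times> T))"
  define s :: "('i \<times> 'a) option rel" where
    "s = {None} \<times> S \<union> {(Some (i, a), Some (i, b)) | i a b. i \<in> I \<and> (a, b) \<in> r}"
  note rfl = order_tree_refl[OF T] and tr = order_tree_trans[OF T]
    and asym = order_tree_antisym[OF T] and fld = order_tree_field[OF T]
  have S_simps [simp]: "None \<in> S" "Some (i, a) \<in> S \<longleftrightarrow> i \<in> I \<and> a \<in> T" for i a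
    by (auto simp: S_def)
  have s_simps [simp]: "(None, v) \<in> s \<longleftrightarrow> v \<in> S" "(Some p, None) \<notin> s"
    "(Some (i, a), Some (j, b)) \<in> s \<longleftrightarrow> i = j \<and> i \<in> I \<and> (a, b) \<in> r" for v p i j a b
    by (auto simp: s_def)
  have s_SomeD: "\<exists>b. v = Some (i, b) \<and> i \<in> I \<and> (a, b) \<in> r" if "(Some (i, a), v) \<in> s" for i a v
    using that by (cases v) auto
  have S: "order_tree S s"
  proof (rule order_treeI)
    have "s \<subseteq> S \<times> S" using fld by (auto simp: s_def)
    moreover have "refl_on S s" using rfl by (auto simp: refl_on_def S_def)
    moreover have "trans s"
    proof (rule transI)
      fix x y z assume "(x, y) \<in> s" "(y, z) \<in> s"
      show "(x, z) \<in> s"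
      proof (cases x)
        case None
        then show ?thesis using \<open>s \<subseteq> S \<times> S\<close> \<open>(y, z) \<in> s\<close> by auto
      next
        case (Some p)
        then obtain i a where "x = Some (i, a)" by (cases p) auto
        then show ?thesis
          using s_SomeD \<open>(x, y) \<in> s\<close> \<open>(y, z) \<in> s\<close> tr s_simps(3) by metis
      qed
    qed
    moreover have "antisym s"
    proof (rule antisymI)
      fix x y assume "(x, y) \<in> s" "(y, x) \<in> s"
      then show "x = y" using asym by (cases x; cases y) auto
    qed
    ultimately show "partial_order_on S s"
      by (simp add: partial_order_on_def preorder_on_def)
    show "None \<in> S" by simp
    show "(None, t) \<in> s" if "t \<in> S" for t using that by simp
    show "(a, b) \<in> s \<or> (b, a) \<in> s" if "(a, c) \<in> s" "(b, c) \<in> s" for a b c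
    proof (cases "a = None \<or> b = None")
      case True
      then show ?thesis using that \<open>s \<subseteq> S \<times> S\<close> by auto
    next
      case False
      then obtain i x j y where ab: "a = Some (i, x)" "b = Some (j, y)" by auto
      then have "i = j" using s_SomeD that by (metis option.inject prod.inject)
      then show ?thesis
        using ab s_SomeD that order_tree_linear[OF T] s_simps(3) by (metis option.inject prod.inject)
    qed
    show "wf (s - Id)"
      unfolding wf_eq_minimal
    proof (intro allI impI)
      fix A and x assume x: "x \<in> (A :: ('i \<times> 'a) option set)"
      show "\<exists>z\<in>A. \<forall>y. (y, z) \<in> s - Id \<longrightarrow> y \<notin> A"
      \<comment> \<open>The root has no proper predecessor and elements outside \<open>S\<close>
        have none at all, so either is minimal at once. Otherwise the search stays in the copy
        containing \<open>x\<close>, since proper predecessors of its nodes lie in that copy or are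
        \<open>None\<close>.\<close>
      proof (cases "None \<in> A \<or> \<not> A \<subseteq> S")
        case True
        then show ?thesis
        proof
          assume "None \<in> A"
          moreover have "(y, None) \<notin> s - Id" for y by (cases y) auto
          ultimately show ?thesis by blast
        next
          assume "\<not> A \<subseteq> S"
          then show ?thesis using \<open>s \<subseteq> S \<times> S\<close> by blast
        qed
      next
        case False
        then obtain i a where a: "Some (i, a) \<in> A" "x = Some (i, a)" using x by (cases x) auto
        define B where "B = {b. Some (i, b) \<in> A}"
        have "B \<subseteq> T" "a \<in> B" using False a by (auto simp: B_def)
        then obtain m where "m \<in> B" "\<And>b. (b, m) \<in> r \<Longrightarrow> b \<noteq> m \<Longrightarrow> b \<notin> B"
          using order_tree_minimal[OF T] by metis
        then have m: "Some (i, m) \<in> A" "\<And>b. (b, m) \<in> r \<Longrightarrow> b \<noteq> m \<Longrightarrow> Some (i, b) \<notin> A"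
          by (simp_all add: B_def)
        have "y \<notin> A" if "(y, Some (i, m)) \<in> s - Id" for y
          using that m False by (cases y) (force, metis (no_types, opaque_lifting) Diff_iff pair_in_Id_conv s_simps(3) surj_pair)
        then show ?thesis using m(1) by blast
      qed
    qed
  qed
  define h where "h = (\<lambda>(R, i). insert None ((\<lambda>t. Some (i :: 'i, t :: 'a)) ` R))"
  have h_mem [simp]: "None \<in> h (R, i)" "Some (j, t) \<in> h (R, i) \<longleftrightarrow> j = i \<and> t \<in> R" for R i j t
    by (auto simp: h_def)
  have h_rays: "h (R, i) \<in> rays S s" if R: "R \<in> rays T r" and i: "i \<in> I" for R i
  proof -
    obtain c where c: "c \<in> R" using R by (auto simp: rays_def)
    have "h (R, i) \<subseteq> S" using rays_subset[OF R] i by (auto simp: h_def)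
    moreover have "h (R, i) \<noteq> {}" by (auto simp: h_def)
    moreover have "under s t \<subseteq> h (R, i)" if "t \<in> h (R, i)" for t
    proof
      fix v assume "v \<in> under s t"
      then show "v \<in> h (R, i)"
        using that rays_down[OF R] by (cases v; cases t) (auto simp: under_def)
    qed
    moreover have "h (R, i) \<in> Chains s"
      using rays_comparable[OF R] rays_subset[OF R] i by (auto simp: h_def Chains_def)
    moreover have "\<not> (\<forall>v\<in>h (R, i). (t, v) \<in> s \<longrightarrow> v = t)" if t: "t \<in> h (R, i)" for t
    proof (cases t)
      case None
      then show ?thesis
        using c i rays_subset[OF R] by (auto intro!: bexI[of _ "Some (i, c)"])
    next
      case (Some p)
      then obtain a where a: "t = Some (i, a)" "a \<in> R" using t by (cases p) auto
      then obtain b where "b \<in> R" "(a, b) \<in> r" "b \<noteq> a" using rays_no_max[OF R] by blast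
      then show ?thesis using a i by (auto intro!: bexI[of _ "Some (i, b)"])
    qed
    ultimately show ?thesis unfolding rays_def by blast
  qed
  \<comment> \<open>Comparability keeps a ray of \<open>S\<close> inside one copy, so a single node
    \<open>Some (i, a)\<close> fixes the index \<open>i\<close>. The openness of \<open>h\<close>
    relies on this too.\<close>
  have h_surj: "\<exists>R\<in>rays T r. Q = h (R, i)" if Q: "Q \<in> rays S s" and p: "Some (i, a) \<in> Q" for Q i a
  proof -
    have i: "i \<in> I" using p rays_subset[OF Q] by auto
    let ?R = "{t. Some (i, t) \<in> Q}"
    have N: "None \<in> Q" using rays_down[OF Q p] p rays_subset[OF Q] by auto
    have same: "j = i" if "Some (j, t) \<in> Q" for j t
      using rays_comparable[OF Q p that] by auto
    have eq: "Q = h (?R, i)"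
    proof (rule set_eqI)
      show "v \<in> Q \<longleftrightarrow> v \<in> h (?R, i)" for v
      proof (cases v)
        case (Some p)
        then show ?thesis using same by (cases p) auto
      qed (use N in simp)
    qed
    have "?R \<subseteq> T" using rays_subset[OF Q] by auto
    moreover have "?R \<noteq> {}" using p by blast
    moreover have "under r t \<subseteq> ?R" if "t \<in> ?R" for t
      using rays_down[OF Q] that i by (auto simp: under_def)
    moreover have "?R \<in> Chains r"
      using rays_comparable[OF Q, of "Some (i, _)" "Some (i, _)"] by (auto simp: Chains_def)
    moreover have "\<not> (\<forall>v\<in>?R. (t, v) \<in> r \<longrightarrow> v = t)" if t: "t \<in> ?R" for t
    proof -
      obtain w where w: "w \<in> Q" "(Some (i, t), w) \<in> s" "w \<noteq> Some (i, t)"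
        using rays_no_max[OF Q] t by blast
      then obtain b where "w = Some (i, b)" by (cases w) auto
      then show ?thesis using w by auto
    qed
    ultimately have "?R \<in> rays T r" unfolding rays_def by blast
    then show ?thesis using eq by blast
  qed
  have h_surj': "\<exists>R i. R \<in> rays T r \<and> i \<in> I \<and> Q = h (R, i)" if Q: "Q \<in> rays S s" for Q
  proof -
    have "\<exists>p. Some p \<in> Q"
    proof (rule ccontr)
      assume "\<nexists>p. Some p \<in> Q"
      \<comment> \<open>The set \<open>{None}\<close> has a maximal element and hence is no
        ray.\<close>
      then have "Q \<subseteq> {None}" by (metis option.exhaust singletonI subsetI)
      then show False using Q by (auto simp: rays_def)
    qed
    then obtain i a where p: "Some (i, a) \<in> Q" by auto
    then have "i \<in> I" using rays_subset[OF Q] by auto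
    then show ?thesis using h_surj[OF Q p] by blast
  qed
  let ?P = "prod_topology (ray_topology T r) (discrete_topology I)"
  have "homeomorphic_map ?P (ray_topology S s) h"
  proof (rule bijective_open_imp_homeomorphic_map)
    show "continuous_map ?P (ray_topology S s) h"
    proof (rule continuous_map_into_ray_topology)
      show "h \<in> topspace ?P \<rightarrow> rays S s" using h_rays by auto
      fix v assume v: "v \<in> S"
      show "continuous_map ?P (discrete_topology UNIV) (\<lambda>x. v \<in> h x)"
      proof (cases v)
        case None
        then have "(\<lambda>x. v \<in> h x) = (\<lambda>x. True)" by (auto simp: h_def)
        then show ?thesis by simp
      next
        case (Some p)
        then obtain i a where ia: "v = Some (i, a)" "i \<in> I" "a \<in> T" using v by (cases p) auto
        have eq: "(\<lambda>x. v \<in> h x) = (\<lambda>x. snd x = i \<and> a \<in> fst x)"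
          using ia by (auto simp: h_def)
        have c1: "continuous_map ?P (discrete_topology UNIV) (\<lambda>x. a \<in> fst x)"
          using continuous_map_compose[OF continuous_map_fst continuous_map_ray_topology_mem[OF ia(3)]]
          by (simp add: comp_def)
        have "continuous_map (discrete_topology I) (discrete_topology UNIV) (\<lambda>j. j = i)"
          by simp
        from continuous_map_compose[OF continuous_map_snd this]
        have c2: "continuous_map ?P (discrete_topology UNIV) (\<lambda>x. snd x = i)"
          by (simp add: comp_def)
        \<comment> \<open>Conjunction is continuous on the discrete square of truth values, so the
          conditions on the index and on the ray can be treated separately.\<close>
        have "continuous_map ?P (discrete_topology UNIV) ((\<lambda>(p, q). p \<and> q) \<circ> (\<lambda>x. (snd x = i, a \<in> fst x)))"
        proof (rule continuous_map_compose)
          show "continuous_map ?P (prod_topology (discrete_topology UNIV) (discrete_topology UNIV))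
             (\<lambda>x. (snd x = i, a \<in> fst x))"
            using c1 c2 by (simp add: continuous_map_pairedI)
          show "continuous_map (prod_topology (discrete_topology UNIV) (discrete_topology UNIV))
             (discrete_topology UNIV) (\<lambda>(p :: bool, q). p \<and> q)"
            by (simp flip: prod_topology_discrete_topology)
        qed
        then show ?thesis by (simp add: eq comp_def)
      qed
    qed
    show "open_map ?P (ray_topology S s) h"
      unfolding open_map_def
    proof (intro allI impI)
      fix V assume V: "openin ?P V"
      show "openin (ray_topology S s) (h ` V)"
        unfolding openin_ray_topology_iff
      proof (intro conjI ballI)
        have "V \<subseteq> rays T r \<times> I" using openin_subset[OF V] by simp
        then show "h ` V \<subseteq> rays S s" using h_rays by auto
        fix Q assume "Q \<in> h ` V"
        then obtain R i where Ri: "(R, i) \<in> V" "Q = h (R, i)" by auto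
        then obtain A B where AB: "openin (ray_topology T r) A" "B \<subseteq> I" "R \<in> A" "i \<in> B" "A \<times> B \<subseteq> V"
          using V unfolding openin_prod_topology_alt by (metis openin_discrete_topology)
        then obtain F where F: "finite F" "F \<subseteq> T" "\<And>Q. Q \<in> rays T r \<Longrightarrow> Q \<inter> F = R \<inter> F \<Longrightarrow> Q \<in> A"
          by (metis openin_ray_topologyE)
        have R: "R \<in> rays T r" and i: "i \<in> I" using Ri(1) \<open>V \<subseteq> rays T r \<times> I\<close> by auto
        then obtain c where c: "c \<in> R" by (auto simp: rays_def)
        \<comment> \<open>The extra node \<open>c\<close> pins down the copy: agreement on
          \<open>F\<close> alone would not force a ray into copy \<open>i\<close> when
          \<open>R\<close> misses \<open>F\<close>.\<close>
        let ?F = "(\<lambda>t. Some (i, t)) ` insert c F"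
        have "finite ?F" "?F \<subseteq> S" using F i c rays_subset[OF R] by auto
        moreover have "W \<in> h ` V" if W: "W \<in> rays S s" "W \<inter> ?F = Q \<inter> ?F" for W
        proof -
          have agree: "Some (i, t) \<in> W \<longleftrightarrow> t \<in> R" if "t \<in> insert c F" for t
          proof -
            have "Some (i, t) \<in> ?F" using that by blast
            then have "Some (i, t) \<in> W \<longleftrightarrow> Some (i, t) \<in> Q" using W(2) by blast
            then show ?thesis by (simp add: Ri(2))
          qed
          then have "Some (i, c) \<in> W" using c by blast
          then obtain R' where R': "R' \<in> rays T r" "W = h (R', i)" using h_surj[OF W(1)] by blast
          then have "R' \<inter> F = R \<inter> F" using agree by auto
          then show ?thesis using F(3) R' AB by blast
        qed
        ultimately show "\<exists>F. finite F \<and> F \<subseteq> S \<and> (\<forall>W\<in>rays S s. W \<inter> F = Q \<inter> F \<longrightarrow> W \<in> h ` V)"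
          by (intro exI[of _ ?F]) blast
      qed
    qed
    show "h ` topspace ?P = topspace (ray_topology S s)"
      using h_rays h_surj' by fastforce
    show "inj_on h (topspace ?P)"
    proof (rule inj_onI, clarsimp)
      fix R i R' i' assume a: "R \<in> rays T r" "R' \<in> rays T r" "h (R, i) = h (R', i')"
      then have "Some (j, t) \<in> h (R, i) \<longleftrightarrow> Some (j, t) \<in> h (R', i')" for j t by simp
      then have *: "j = i \<and> t \<in> R \<longleftrightarrow> j = i' \<and> t \<in> R'" for j t by simp
      \<comment> \<open>The index can be recovered because a ray is non-empty.\<close>
      obtain c where "c \<in> R" using a(1) by (auto simp: rays_def)
      then have "i = i'" using *[of i c] by simp
      then show "R = R' \<and> i = i'" using * by blast
    qed
  qed
  then have "?P homeomorphic_space ray_topology S s"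
    by (rule homeomorphic_map_imp_homeomorphic_space)
  then show ?thesis by (rule ray_spaceI[OF S])
qed

theorem theorem6p4:
  fixes T :: "'a set" and r :: "'a rel" and T' :: "'b set" and r' :: "'b rel"
  assumes "order_tree T r" and "pruned T r"
    and "\<exists>R\<in>rays T r. uncountable (tops T r R)"
    and "order_tree T' r'"
  shows "ray_topology T' r' = discrete_topology (rays T' r') \<longleftrightarrow>
         ray_space (prod_topology (ray_topology T r) (ray_topology T' r'))"
proof
  assume "ray_topology T' r' = discrete_topology (rays T' r')"
  then show "ray_space (prod_topology (ray_topology T r) (ray_topology T' r'))"
    using ray_space_prod_discrete[OF assms(1)] by metis
next
  assume "ray_space (prod_topology (ray_topology T r) (ray_topology T' r'))"
  then show "ray_topology T' r' = discrete_topology (rays T' r')"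
    using discrete_if_prod_ray_space assms by metis
qed

end
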